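(* Let $n\ge1$, $0\le r\le n$ and let $i_1,\dots,i_{n-r}$ be non-negative integers. In $P_n\otimes E_n^r$ there holds $$[r:i_1,\dots,i_{n-r}]=(-1)^{(n-r)r}Q_{i_{n-r}}\cdots Q_{i_1}dx_1\cdots dx_n=(-1)^{(n-r)r+(n-r)(n-r-1)/2}Q_{i_1}\cdots Q_{i_{n-r}}dx_1\cdots dx_n.$$
   Context: Let $p$ be an odd prime, $q$ a power of $p$. $P_n=\mathbb{F}_q[x_1,\dots,x_n]$; $E_n=\Lambda(dx_1,\dots,dx_n)$ is the exterior algebra over $\mathbb{F}_q$, $E_n^r=\Lambda^r(dx_1,\dots,dx_n)$. $P_n\otimes E_n$ is graded by $\deg x_i=2$, $\deg dx_i=1$. For $j\ge0$ the Milnor operation $Q_j:P_n\otimes E_n^r\to P_n\otimes E_n^{r-1}$ is the $P_n$-linear derivation determined by $Q_j(xy)=(Q_jx)y+(-1)^{\deg x}x(Q_jy)$, $Q_j\,dx_i=x_i^{q^j}$, $Q_jx_i=0$. Dickson invariant: $[i_1,\dots,i_k](y_1,\dots,y_k)=\sum_\sigma \mathrm{sgn}(\sigma)\,y_{\sigma(1)}^{q^{i_1}}\cdots y_{\sigma(k)}^{q^{i_k}}=\det(y_j^{q^{i_\ell}})$, $\sigma$ ranging over permutations of $\{1,\dots,k\}$ (it equals $1$ for $k=0$). Mùi invariant: $[r:i_1,\dots,i_{n-r}]=\sum_J\mathrm{sgn}(\sigma_J)\,dx_{j_1}\cdots dx_{j_r}\,[i_1,\dots,i_{n-r}](x_{j_{r+1}},\dots,x_{j_n})\in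 P_n\otimes E_n^r$, where $J=\{j_1,\dots,j_r\}$ ranges over the $r$-element subsets of $\{1,\dots,n\}$ and $\sigma_J$ is the permutation $k\mapsto j_k$ of $\{1,\dots,n\}$ with $j_1<\dots<j_r$ and $j_{r+1}<\dots<j_n$. *)

theory Defs
  imports
    "HOL-Library.Poly_Mapping"
    "HOL-Library.FuncSet"
    "HOL-Library.Cardinality"
    "HOL-Computational_Algebra.Primes"
    "HOL-Combinatorics.Permutations"
begin

section \<open>The exterior algebra on generators indexed by the natural numbers\<close>

text \<open>
  An element of the exterior algebra over a commutative ring is given by its coefficients
  in the standard basis \<open>ebasis J = e J = e j\<^sub>1 \<cdots> e j\<^sub>r\<close> for finite \<open>J = {j\<^sub>1 < \<cdots> < j\<^sub>r}\<close>.
  If \<open>J\<close> and \<open>K\<close> are disjoint, sorting the product \<open>e J * e K\<close> takes \<open>crossings J K\<close>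
  adjacent swaps, so that \<open>e J * e K = (-1) ^ crossings J K * e (J \<union> K)\<close>; if they are not
  disjoint, the product is \<open>0\<close>.
\<close>

typedef (overloaded) 'a ext =
  "{f :: nat set \<Rightarrow> 'a::zero. finite {J. f J \<noteq> 0} \<and> (\<forall>J. infinite J \<longrightarrow> f J = 0)}"
  morphisms ecoeff Abs_ext
  by (rule exI [of _ "\<lambda>_. 0"]) simp

setup_lifting type_definition_ext

lemma ecoeff_infinite [simp]: "infinite J \<Longrightarrow> ecoeff f J = 0"
  using ecoeff [of f] by simp

lemma finite_support [simp]: "finite {J. ecoeff f J \<noteq> 0}"
  using ecoeff [of f] by simp

lemma ext_eqI:
  assumes "\<And>J. finite J \<Longrightarrow> ecoeff f J = ecoeff g J"
  shows "f = g"
proof -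
  have "ecoeff f J = ecoeff g J" for J
    by (cases "finite J") (auto simp: assms)
  then show ?thesis
    by (simp add: ecoeff_inject [symmetric] fun_eq_iff)
qed

definition crossings :: "nat set \<Rightarrow> nat set \<Rightarrow> nat" where
  "crossings J K = card {(a, b). a \<in> J \<and> b \<in> K \<and> b < a}"

lemma finite_crossings: "finite J \<Longrightarrow> finite K \<Longrightarrow> finite {(a, b). a \<in> J \<and> b \<in> K \<and> b < a}"
  for J K :: "nat set"
  by (rule finite_subset [of _ "J \<times> K"]) auto

lemma crossings_empty [simp]: "crossings {} K = 0" "crossings J {} = 0"
  by (simp_all add: crossings_def)

lemma crossings_Un_left:
  assumes "finite J" "finite J'" "finite K" "J \<inter> J' = {}"
  shows "crossings (J \<union> J') K = crossings J K + crossings J' K"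
proof -
  have "{(a, b). a \<in> J \<union> J' \<and> b \<in> K \<and> b < a} =
      {(a, b). a \<in> J \<and> b \<in> K \<and> b < a} \<union> {(a, b). a \<in> J' \<and> b \<in> K \<and> b < a}"
    by auto
  then show ?thesis
    unfolding crossings_def using assms
    by (simp only:) (intro card_Un_disjoint finite_crossings; auto)
qed

lemma crossings_Un_right:
  assumes "finite J" "finite K" "finite K'" "K \<inter> K' = {}"
  shows "crossings J (K \<union> K') = crossings J K + crossings J K'"
proof -
  have "{(a, b). a \<in> J \<and> b \<in> K \<union> K' \<and> b < a} =
      {(a, b). a \<in> J \<and> b \<in> K \<and> b < a} \<union> {(a, b). a \<in> J \<and> b \<in> K' \<and> b < a}"
    by auto
  then show ?thesis
    unfolding crossings_def using assms
    by (simp only:) (intro card_Un_disjoint finite_crossings; auto)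
qed

lemma crossings_single_left: "crossings {i} K = card {k \<in> K. k < i}"
proof -
  have "{(a, b). a \<in> {i} \<and> b \<in> K \<and> b < a} = Pair i ` {k \<in> K. k < i}"
    by auto
  then show ?thesis
    by (simp add: crossings_def card_image inj_on_def)
qed

lemma crossings_single_right: "crossings J {i} = card {j \<in> J. i < j}"
proof -
  have "{(a, b). a \<in> J \<and> b \<in> {i} \<and> b < a} = (\<lambda>j. (j, i)) ` {j \<in> J. i < j}"
    by auto
  then show ?thesis
    by (simp add: crossings_def card_image inj_on_def)
qed

lemma crossings_single_both:
  assumes "finite J" "i \<notin> J"
  shows "crossings J {i} + crossings {i} J = card J"
proof -
  have "i < j \<or> j < i" if "j \<in> J" for j
    using that assms(2) by (metis linorder_neqE_nat)
  then have J: "{j \<in> J. i < j} \<union> {k \<in> J. k < i} = J"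
    by blast
  have "card ({j \<in> J. i < j} \<union> {k \<in> J. k < i}) = card {j \<in> J. i < j} + card {k \<in> J. k < i}"
    using assms(1) by (intro card_Un_disjoint) auto
  then have "card J = card {j \<in> J. i < j} + card {k \<in> J. k < i}"
    unfolding J .
  then show ?thesis
    by (simp add: crossings_single_left crossings_single_right)
qed

instantiation ext :: (ab_group_add) ab_group_add
begin

lift_definition zero_ext :: "'a ext" is "\<lambda>_. 0"
  by simp

lift_definition plus_ext :: "'a ext \<Rightarrow> 'a ext \<Rightarrow> 'a ext" is "\<lambda>f g J. f J + g J"
  subgoal for f g
    by (auto intro: finite_subset [of _ "{J. f J \<noteq> 0} \<union> {J. g J \<noteq> 0}"])
  done

lift_definition uminus_ext :: "'a ext \<Rightarrow> 'a ext" is "\<lambda>f J. - f J"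
  by simp

lift_definition minus_ext :: "'a ext \<Rightarrow> 'a ext \<Rightarrow> 'a ext" is "\<lambda>f g J. f J - g J"
  subgoal for f g
    by (auto intro: finite_subset [of _ "{J. f J \<noteq> 0} \<union> {J. g J \<noteq> 0}"])
  done

instance
  by standard (transfer; simp add: fun_eq_iff algebra_simps)+

end

lemma ecoeff_zero [simp]: "ecoeff 0 J = 0"
  by transfer simp

lemma ecoeff_plus [simp]: "ecoeff (f + g) J = ecoeff f J + ecoeff g J"
  by transfer simp

lemma ecoeff_uminus [simp]: "ecoeff (- f) J = - ecoeff f J"
  by transfer simp

lemma ecoeff_minus [simp]: "ecoeff (f - g) J = ecoeff f J - ecoeff g J"
  by transfer simp

lemma ecoeff_sum [simp]: "ecoeff (\<Sum>i\<in>A. f i) J = (\<Sum>i\<in>A. ecoeff (f i) J)"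
  by (induction A rule: infinite_finite_induct) auto

instantiation ext :: (comm_ring_1) ring_1
begin

lift_definition one_ext :: "'a ext" is "\<lambda>J. if J = {} then 1 else 0"
  by simp

lift_definition times_ext :: "'a ext \<Rightarrow> 'a ext \<Rightarrow> 'a ext" is
  "\<lambda>f g L. \<Sum>J\<in>Pow L. (-1) ^ crossings J (L - J) * f J * g (L - J)"
  subgoal for f g
  proof (intro conjI allI impI)
    assume f: "finite {J. f J \<noteq> 0} \<and> (\<forall>J. infinite J \<longrightarrow> f J = 0)"
      and g: "finite {J. g J \<noteq> 0} \<and> (\<forall>J. infinite J \<longrightarrow> g J = 0)"
    let ?S = "(\<lambda>(J, K). J \<union> K) ` ({J. f J \<noteq> 0} \<times> {J. g J \<noteq> 0})"
    have "L \<in> ?S"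
      if nz: "(\<Sum>J\<in>Pow L. (-1) ^ crossings J (L - J) * f J * g (L - J)) \<noteq> 0" for L
    proof -
      obtain J where "J \<in> Pow L" "(-1) ^ crossings J (L - J) * f J * g (L - J) \<noteq> 0"
        using sum.not_neutral_contains_not_neutral [OF nz] by blast
      then have "f J \<noteq> 0" "g (L - J) \<noteq> 0" "L = J \<union> (L - J)"
        by auto
      then show ?thesis
        by blast
    qed
    then have "{L. (\<Sum>J\<in>Pow L. (-1) ^ crossings J (L - J) * f J * g (L - J)) \<noteq> 0} \<subseteq> ?S"
      by blast
    moreover have "finite ?S"
      using f g by simp
    ultimately show "finite {L. (\<Sum>J\<in>Pow L. (-1) ^ crossings J (L - J) * f J * g (L - J)) \<noteq> 0}"
      by (rule finite_subset)
  qed simp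
  done

lemma ecoeff_one: "ecoeff (1 :: 'a ext) J = (if J = {} then 1 else 0)"
  by transfer simp

lemma ecoeff_times:
  "ecoeff (f * g :: 'a ext) L =
    (\<Sum>J\<in>Pow L. (-1) ^ crossings J (L - J) * ecoeff f J * ecoeff g (L - J))"
  by transfer simp

instance
proof
  fix f g h :: "'a ext"
  show "f * g * h = f * (g * h)"
  proof (rule ext_eqI)
    fix L :: "nat set" assume L: "finite L"
    have "ecoeff (f * g * h) L = (\<Sum>K\<in>Pow L. \<Sum>J\<in>Pow K.
        (-1) ^ (crossings K (L - K) + crossings J (K - J)) *
          (ecoeff f J * ecoeff g (K - J) * ecoeff h (L - K)))"
      unfolding ecoeff_times sum_distrib_left sum_distrib_right
      by (intro sum.cong refl) (simp only: power_add mult_ac)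
    also have "\<dots> = (\<Sum>(K, J)\<in>Sigma (Pow L) Pow.
        (-1) ^ (crossings K (L - K) + crossings J (K - J)) *
          (ecoeff f J * ecoeff g (K - J) * ecoeff h (L - K)))"
      using L by (intro sum.Sigma) (auto intro: finite_subset [OF _ L])
    also have "\<dots> = (\<Sum>(J, B)\<in>Sigma (Pow L) (\<lambda>J. Pow (L - J)).
        (-1) ^ (crossings J (L - J) + crossings B (L - J - B)) *
          (ecoeff f J * ecoeff g B * ecoeff h (L - J - B)))"
    proof (rule sum.reindex_bij_witness
        [of _ "\<lambda>(J, B). (J \<union> B, J)" "\<lambda>(K, J). (J, K - J)"], goal_cases)
      case (5 x)
      obtain K J where x: "x = (K, J)" and KJ: "K \<subseteq> L" "J \<subseteq> K"
        using 5 by auto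
      have f: "finite J" "finite (K - J)" "finite (L - K)"
        using KJ by (auto intro: finite_subset [OF _ L])
      have "crossings (J \<union> (K - J)) (L - K) = crossings J (L - K) + crossings (K - J) (L - K)"
        using f by (intro crossings_Un_left) auto
      moreover have "J \<union> (K - J) = K"
        using KJ by auto
      moreover have "crossings J ((K - J) \<union> (L - K)) = crossings J (K - J) + crossings J (L - K)"
        using f by (intro crossings_Un_right) auto
      moreover have "(K - J) \<union> (L - K) = L - J"
        using KJ by auto
      moreover have D: "L - J - (K - J) = L - K"
        using KJ by auto
      ultimately have "crossings J (L - J) + crossings (K - J) (L - J - (K - J)) =
          crossings K (L - K) + crossings J (K - J)"
        by simp
      then show ?case
        unfolding x prod.case D by simp
    qed auto
    also have "\<dots> = (\<Sum>J\<in>Pow L. \<Sum>B\<in>Pow (L - J).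
        (-1) ^ (crossings J (L - J) + crossings B (L - J - B)) *
          (ecoeff f J * ecoeff g B * ecoeff h (L - J - B)))"
      using L by (intro sum.Sigma [symmetric]) auto
    also have "\<dots> = ecoeff (f * (g * h)) L"
      unfolding ecoeff_times sum_distrib_left sum_distrib_right
      by (intro sum.cong refl) (simp only: power_add mult_ac)
    finally show "ecoeff (f * g * h) L = ecoeff (f * (g * h)) L" .
  qed
  show "1 * f = f"
  proof (rule ext_eqI)
    fix L :: "nat set" assume L: "finite L"
    have "ecoeff (1 * f) L =
        (\<Sum>J\<in>Pow L. if J = {} then (-1) ^ crossings J (L - J) * ecoeff f (L - J) else 0)"
      unfolding ecoeff_times ecoeff_one by (rule sum.cong) simp_all
    also have "\<dots> = ecoeff f L"
      using L by (subst sum.delta) simp_all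
    finally show "ecoeff (1 * f) L = ecoeff f L" .
  qed
  show "f * 1 = f"
  proof (rule ext_eqI)
    fix L :: "nat set" assume L: "finite L"
    have "ecoeff (f * 1) L =
        (\<Sum>J\<in>Pow L. if J = L then (-1) ^ crossings J (L - J) * ecoeff f J else 0)"
      unfolding ecoeff_times ecoeff_one
    proof (rule sum.cong [OF refl])
      fix J assume "J \<in> Pow L"
      then have "L - J = {} \<longleftrightarrow> J = L"
        by blast
      then show "(-1) ^ crossings J (L - J) * ecoeff f J * (if L - J = {} then 1 else 0) =
          (if J = L then (-1) ^ crossings J (L - J) * ecoeff f J else 0)"
        by simp
    qed
    also have "\<dots> = ecoeff f L"
      using L by (subst sum.delta) simp_all
    finally show "ecoeff (f * 1) L = ecoeff f L" .
  qed
  show "(f + g) * h = f * h + g * h"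
  proof (rule ext_eqI)
    fix L :: "nat set"
    show "ecoeff ((f + g) * h) L = ecoeff (f * h + g * h) L"
      unfolding ecoeff_plus ecoeff_times sum.distrib [symmetric]
      by (intro sum.cong refl) (simp only: distrib_left distrib_right)
  qed
  show "f * (g + h) = f * g + f * h"
  proof (rule ext_eqI)
    fix L :: "nat set"
    show "ecoeff (f * (g + h)) L = ecoeff (f * g + f * h) L"
      unfolding ecoeff_plus ecoeff_times sum.distrib [symmetric]
      by (intro sum.cong refl) (simp only: distrib_left)
  qed
  have "ecoeff (0 :: 'a ext) {} \<noteq> ecoeff 1 {}"
    by (simp add: ecoeff_one)
  then show "(0 :: 'a ext) \<noteq> 1"
    by (rule contrapos_nn) (simp only:)
qed

end

lift_definition econst :: "'a \<Rightarrow> 'a::comm_ring_1 ext" is "\<lambda>c J. if J = {} then c else 0"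
  by (auto intro: finite_subset [of _ "{{}}"])

lift_definition ebasis :: "nat set \<Rightarrow> 'a::comm_ring_1 ext" is
  "\<lambda>J K. if finite J \<and> K = J then 1 else 0"
  subgoal for J by (auto intro: finite_subset [of _ "{J}"])
  done

lemma ecoeff_econst: "ecoeff (econst c) J = (if J = {} then c else 0)"
  by transfer simp

lemma ecoeff_ebasis: "ecoeff (ebasis J) K = (if finite J \<and> K = J then 1 else 0)"
  by transfer simp

lemma ecoeff_econst_mult [simp]: "ecoeff (econst c * f) L = c * ecoeff f L"
proof (cases "finite L")
  case True
  then have "ecoeff (econst c * f) L =
      (\<Sum>J\<in>Pow L. if J = {} then (-1) ^ crossings J (L - J) * c * ecoeff f (L - J) else 0)"
    unfolding ecoeff_times ecoeff_econst by (intro sum.cong) auto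
  then show ?thesis
    using True by simp
qed simp

lemma ecoeff_mult_econst [simp]: "ecoeff (f * econst c) L = c * ecoeff f L"
proof (cases "finite L")
  case True
  then have "ecoeff (f * econst c) L =
      (\<Sum>J\<in>Pow L. if J = L then (-1) ^ crossings J (L - J) * ecoeff f J * c else 0)"
    unfolding ecoeff_times ecoeff_econst by (intro sum.cong) auto
  then show ?thesis
    using True by (simp add: mult.commute)
qed simp

lemma ecoeff_sign_mult [simp]: "ecoeff ((-1) ^ k * f) L = (-1) ^ k * ecoeff f L"
  for f :: "'a::comm_ring_1 ext"
  by (cases "even k") auto

lemma econst_commute: "econst c * f = f * econst c"
  by (rule ext_eqI) simp

lemma econst_hom:
  "econst 0 = 0" "econst 1 = 1" "econst (a + b) = econst a + econst b"
  "econst (a * b) = econst a * econst b"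
  by (rule ext_eqI; simp add: ecoeff_econst ecoeff_one)+

lemma ebasis_empty: "ebasis {} = 1"
  by (rule ext_eqI) (simp add: ecoeff_ebasis ecoeff_one)

lemma ebasis_mult:
  assumes "finite J" "finite K"
  shows "ebasis J * ebasis K =
    (if J \<inter> K = {} then (-1) ^ crossings J K * ebasis (J \<union> K) else (0 :: 'a::comm_ring_1 ext))"
proof (rule ext_eqI)
  fix L :: "nat set" assume L: "finite L"
  have "ecoeff (ebasis J * ebasis K :: 'a ext) L =
      (\<Sum>I\<in>Pow L. if I = J then if L - J = K then (-1) ^ crossings J K else 0 else 0)"
    using assms unfolding ecoeff_times ecoeff_ebasis by (intro sum.cong) auto
  also have "\<dots> = (if J \<subseteq> L \<and> L - J = K then (-1) ^ crossings J K else 0)"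
    using L by simp
  also have "J \<subseteq> L \<and> L - J = K \<longleftrightarrow> J \<inter> K = {} \<and> L = J \<union> K"
    by auto
  finally show "ecoeff (ebasis J * ebasis K) L = ecoeff
      (if J \<inter> K = {} then (-1) ^ crossings J K * ebasis (J \<union> K) else (0 :: 'a ext)) L"
    using assms by (auto simp: ecoeff_ebasis)
qed

lemma ebasis_square: "ebasis {i} * ebasis {i} = 0"
  by (simp add: ebasis_mult)

lemma ebasis_anticommute:
  "ebasis {i} * ebasis {j} = - (ebasis {j} * ebasis {i} :: 'a::comm_ring_1 ext)"
proof -
  have lt: "ebasis {i} * ebasis {j} = - (ebasis {j} * ebasis {i} :: 'a ext)" if "i < j" for i j :: nat
  proof -
    have "{k \<in> {j}. k < i} = {}" "{k \<in> {i}. k < j} = {i}"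
      using that by auto
    then have "crossings {i} {j} = 0" "crossings {j} {i} = 1"
      by (simp_all only: crossings_single_left) simp_all
    with that show ?thesis
      by (simp add: ebasis_mult insert_commute)
  qed
  show ?thesis
  proof (cases i j rule: linorder_cases)
    case less
    then show ?thesis by (rule lt)
  next
    case equal
    then show ?thesis by (simp add: ebasis_square)
  next
    case greater
    from lt [OF this] show ?thesis by simp
  qed
qed

lemma ext_expand:
  assumes "finite A" and "\<And>J. ecoeff f J \<noteq> 0 \<Longrightarrow> J \<subseteq> A"
  shows "f = (\<Sum>J\<in>Pow A. econst (ecoeff f J) * ebasis J)"
proof (rule ext_eqI)
  fix K :: "nat set" assume K: "finite K"
  have "(\<Sum>J\<in>Pow A. ecoeff (econst (ecoeff f J) * ebasis J) K) =
      (\<Sum>J\<in>Pow A. if J = K then ecoeff f K else 0)"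
    using K by (intro sum.cong) (auto simp: ecoeff_ebasis)
  also have "\<dots> = ecoeff f K"
    using assms K by auto
  finally show "ecoeff f K = ecoeff (\<Sum>J\<in>Pow A. econst (ecoeff f J) * ebasis J) K"
    by simp
qed


section \<open>Polynomials and polynomial differential forms\<close>

type_synonym 'a mpoly = "(nat \<Rightarrow>\<^sub>0 nat) \<Rightarrow>\<^sub>0 'a"

text \<open>
  \<open>P\<^sub>n \<otimes> E\<^sub>n\<close> is the exterior algebra over \<open>P\<^sub>n\<close> on \<open>dx\<^sub>1, \<dots>, dx\<^sub>n\<close>. No signs arise from moving
  elements of \<open>P\<^sub>n\<close> past elements of \<open>E\<^sub>n\<close>, because the \<open>x\<^sub>i\<close> have even degree. The types below
  have variables with arbitrary natural numbers as indices; \<open>PE n\<close> is the subring \<open>P\<^sub>n \<otimes> E\<^sub>n\<close>.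
\<close>

type_synonym 'a form = "'a mpoly ext"

definition X :: "nat \<Rightarrow> 'a::comm_ring_1 mpoly" where
  "X i = Poly_Mapping.single (Poly_Mapping.single i 1) 1"

definition dX :: "nat \<Rightarrow> 'a::comm_ring_1 form" where
  "dX i = ebasis {i}"

definition polys :: "nat \<Rightarrow> 'a::comm_ring_1 mpoly set" where
  "polys n = {f. \<forall>m\<in>Poly_Mapping.keys f. Poly_Mapping.keys m \<subseteq> {1..n}}"

definition PE :: "nat \<Rightarrow> 'a::comm_ring_1 form set" where
  "PE n = {f. \<forall>J. ecoeff f J \<in> polys n \<and> (ecoeff f J \<noteq> 0 \<longrightarrow> J \<subseteq> {1..n})}"

text \<open>The submodule \<open>P\<^sub>n \<otimes> E\<^sub>n\<^sup>r\<close>.\<close>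

definition PE_ext :: "nat \<Rightarrow> nat \<Rightarrow> 'a::comm_ring_1 form set" where
  "PE_ext n r = {f \<in> PE n. \<forall>J. ecoeff f J \<noteq> 0 \<longrightarrow> card J = r}"

text \<open>The elements of total degree \<open>d\<close>, where \<open>deg x\<^sub>i = 2\<close> and \<open>deg dx\<^sub>i = 1\<close>.\<close>

definition mdeg :: "(nat \<Rightarrow>\<^sub>0 nat) \<Rightarrow> nat" where
  "mdeg m = (\<Sum>i\<in>Poly_Mapping.keys m. Poly_Mapping.lookup m i)"

definition PE_deg :: "nat \<Rightarrow> nat \<Rightarrow> 'a::comm_ring_1 form set" where
  "PE_deg n d =
    {f \<in> PE n. \<forall>J. \<forall>m\<in>Poly_Mapping.keys (ecoeff f J). 2 * mdeg m + card J = d}"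

lemma polys_zero [simp]: "0 \<in> polys n"
  by (simp add: polys_def)

lemma polys_one [simp]: "1 \<in> polys n"
  by (simp add: polys_def)

lemma polys_add [intro]: "a \<in> polys n \<Longrightarrow> b \<in> polys n \<Longrightarrow> a + b \<in> polys n"
  using keys_add [of a b] unfolding polys_def by blast

lemma polys_uminus [intro]: "a \<in> polys n \<Longrightarrow> - a \<in> polys n"
  by (simp add: polys_def)

lemma polys_mult [intro]: "a \<in> polys n \<Longrightarrow> b \<in> polys n \<Longrightarrow> a * b \<in> polys n"
proof -
  assume a: "a \<in> polys n" and b: "b \<in> polys n"
  have "Poly_Mapping.keys m \<subseteq> {1..n}" if "m \<in> Poly_Mapping.keys (a * b)" for m
  proof -
    obtain k l where "m = k + l" "k \<in> Poly_Mapping.keys a" "l \<in> Poly_Mapping.keys b"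
      using \<open>m \<in> Poly_Mapping.keys (a * b)\<close> keys_mult [of a b] by blast
    then show ?thesis
      using a b keys_add [of k l] unfolding polys_def by blast
  qed
  then show ?thesis
    by (simp add: polys_def)
qed

lemma polys_power [intro]: "a \<in> polys n \<Longrightarrow> a ^ k \<in> polys n"
  by (induction k) auto

lemma polys_sum [intro]: "(\<And>i. i \<in> A \<Longrightarrow> f i \<in> polys n) \<Longrightarrow> sum f A \<in> polys n"
  by (induction A rule: infinite_finite_induct) auto

lemma polys_sign [intro]: "a \<in> polys n \<Longrightarrow> (-1) ^ k * a \<in> polys n"
  by (cases "even k") auto

lemma polys_X [simp]: "i \<in> {1..n} \<Longrightarrow> X i \<in> polys n"
  by (simp add: polys_def X_def)

lemma PE_subset: "f \<in> PE n \<Longrightarrow> ecoeff f J \<noteq> 0 \<Longrightarrow> J \<subseteq> {1..n}"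
  unfolding PE_def by blast

lemma PE_coeff: "f \<in> PE n \<Longrightarrow> ecoeff f J \<in> polys n"
  unfolding PE_def by blast

lemma PE_add [intro]:
  assumes "f \<in> PE n" "g \<in> PE n"
  shows "f + g \<in> PE n"
proof -
  have "J \<subseteq> {1..n}" if "ecoeff f J + ecoeff g J \<noteq> 0" for J
    using that assms by (metis PE_subset add_0)
  with assms show ?thesis
    unfolding PE_def by auto
qed

lemma PE_zero [simp]: "0 \<in> PE n"
  by (simp add: PE_def)

lemma PE_sum [intro]: "(\<And>i. i \<in> A \<Longrightarrow> f i \<in> PE n) \<Longrightarrow> sum f A \<in> PE n"
  by (induction A rule: infinite_finite_induct) auto

lemma PE_econst_mult [intro]:
  assumes "c \<in> polys n" "f \<in> PE n"
  shows "econst c * f \<in> PE n"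
proof -
  have "J \<subseteq> {1..n}" if "c * ecoeff f J \<noteq> 0" for J
    using PE_subset [OF assms(2), of J] that by (metis mult_zero_right)
  then show ?thesis
    using assms by (auto simp: PE_def)
qed

lemma PE_ebasis [intro]: "J \<subseteq> {1..n} \<Longrightarrow> ebasis J \<in> PE n"
  by (auto simp: PE_def ecoeff_ebasis)

lemma PE_econst [intro]: "c \<in> polys n \<Longrightarrow> econst c \<in> PE n"
  by (simp add: PE_def ecoeff_econst)

lemma PE_mult [intro]:
  assumes f: "f \<in> PE n" and g: "g \<in> PE n"
  shows "f * g \<in> PE n"
proof -
  have "ecoeff (f * g) J \<in> polys n" for J
    unfolding ecoeff_times by (intro polys_sum polys_mult polys_sign PE_coeff f g)
  moreover have "L \<subseteq> {1..n}" if nz: "ecoeff (f * g) L \<noteq> 0" for L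
  proof -
    obtain J where J: "J \<in> Pow L" "(-1) ^ crossings J (L - J) * ecoeff f J * ecoeff g (L - J) \<noteq> 0"
      using sum.not_neutral_contains_not_neutral [OF nz [unfolded ecoeff_times]] by blast
    then have "ecoeff f J \<noteq> 0" "ecoeff g (L - J) \<noteq> 0"
      by auto
    then show ?thesis
      using PE_subset [OF f] PE_subset [OF g] J(1) by blast
  qed
  ultimately show ?thesis
    by (simp add: PE_def)
qed

lemma PE_deg_parity:
  assumes "f \<in> PE_deg n d" "ecoeff f J \<noteq> 0"
  shows "even (card J) \<longleftrightarrow> even d"
proof -
  from assms(2) obtain m where "m \<in> Poly_Mapping.keys (ecoeff f J)"
    by (metis all_not_in_conv keys_eq_empty)
  with assms(1) have "2 * mdeg m + card J = d"
    by (simp add: PE_deg_def)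
  then show ?thesis
    by presburger
qed

lemma dX_deg: "i \<in> {1..n} \<Longrightarrow> dX i \<in> PE_deg n 1"
  by (auto simp: PE_deg_def dX_def ecoeff_ebasis mdeg_def split: if_splits)


section \<open>Milnor operations\<close>

text \<open>
  The operator is only meaningful on \<open>PE n\<close>; requiring it to be extensional makes it unique.
  Existence and uniqueness are shown in \<open>is_milnor_contract\<close> and \<open>is_milnor_unique\<close>.
\<close>

definition is_milnor :: "nat \<Rightarrow> nat \<Rightarrow> nat \<Rightarrow> ('a::comm_ring_1 form \<Rightarrow> 'a form) \<Rightarrow> bool" where
  "is_milnor q n j D \<longleftrightarrow>
    D \<in> extensional (PE n) \<and>
    (\<forall>r. \<forall>f\<in>PE_ext n (Suc r). D f \<in> PE_ext n r) \<and>
    (\<forall>f\<in>PE_ext n 0. D f = 0) \<and>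
    (\<forall>f\<in>PE n. \<forall>g\<in>PE n. D (f + g) = D f + D g) \<and>
    (\<forall>c\<in>polys n. \<forall>f\<in>PE n. D (econst c * f) = econst c * D f) \<and>
    (\<forall>d. \<forall>f\<in>PE_deg n d. \<forall>g\<in>PE n. D (f * g) = D f * g + (-1) ^ d * f * D g) \<and>
    (\<forall>i\<in>{1..n}. D (dX i) = econst (X i ^ q ^ j)) \<and>
    (\<forall>i\<in>{1..n}. D (econst (X i)) = 0)"

definition milnor :: "nat \<Rightarrow> nat \<Rightarrow> nat \<Rightarrow> 'a::comm_ring_1 form \<Rightarrow> 'a form" where
  "milnor q n j = (THE D. is_milnor q n j D)"

text \<open>Existence: \<open>Q\<^sub>j\<close> is the sum of the operators \<open>x\<^sub>i ^ q ^ j * contract i\<close>.\<close>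

lift_definition contract :: "nat \<Rightarrow> 'a::comm_ring_1 ext \<Rightarrow> 'a ext" is
  "\<lambda>i f K. if i \<in> K then 0 else (-1) ^ crossings {i} K * f (insert i K)"
  subgoal for i f
  proof (intro conjI allI impI)
    assume f: "finite {J. f J \<noteq> 0} \<and> (\<forall>J. infinite J \<longrightarrow> f J = 0)"
    have "K \<in> (\<lambda>J. J - {i}) ` {J. f J \<noteq> 0}"
      if "(if i \<in> K then 0 else (-1) ^ crossings {i} K * f (insert i K)) \<noteq> 0" for K
    proof (rule image_eqI)
      show "K = insert i K - {i}" "insert i K \<in> {J. f J \<noteq> 0}"
        using that by (auto split: if_splits)
    qed
    then have "{K. (if i \<in> K then 0 else (-1) ^ crossings {i} K * f (insert i K)) \<noteq> 0} \<subseteq>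
        (\<lambda>J. J - {i}) ` {J. f J \<noteq> 0}"
      by blast
    then show "finite {K. (if i \<in> K then 0 else (-1) ^ crossings {i} K * f (insert i K)) \<noteq> 0}"
      using f by (elim finite_subset) simp
  qed simp
  done

lemma ecoeff_contract:
  "ecoeff (contract i f) K =
    (if i \<in> K then 0 else (-1) ^ crossings {i} K * ecoeff f (insert i K))"
  by transfer simp

lemma contract_plus: "contract i (f + g) = contract i f + contract i g"
  by (rule ext_eqI) (simp add: ecoeff_contract distrib_left)

lemma contract_econst_mult: "contract i (econst c * f) = econst c * contract i f"
  by (rule ext_eqI) (simp add: ecoeff_contract mult_ac)

lemma contract_econst: "contract i (econst c) = 0"
  by (rule ext_eqI) (simp add: ecoeff_contract ecoeff_econst)

lemma contract_generator: "contract k (ebasis {i}) = (if k = i then 1 else 0)"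
  by (rule ext_eqI) (auto simp: ecoeff_contract ecoeff_ebasis ecoeff_one)

lemma sum_Pow_insert:
  assumes "finite M" "i \<notin> M"
  shows "sum F (Pow (insert i M)) = (\<Sum>J\<in>Pow M. F J + F (insert i J))"
proof -
  have "sum F (Pow (insert i M)) = sum F (Pow M) + sum F (insert i ` Pow M)"
    unfolding Pow_insert using assms by (intro sum.union_disjoint) auto
  also have "sum F (insert i ` Pow M) = (\<Sum>J\<in>Pow M. F (insert i J))"
    using assms by (subst sum.reindex) (auto simp: inj_on_def)
  finally show ?thesis
    by (simp add: sum.distrib)
qed

lemma contract_mult:
  fixes f g :: "'a::comm_ring_1 ext"
  assumes parity: "\<And>J. ecoeff f J \<noteq> 0 \<Longrightarrow> even (card J) \<longleftrightarrow> even d"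
  shows "contract i (f * g) = contract i f * g + (-1) ^ d * f * contract i g"
proof (rule ext_eqI)
  fix L :: "nat set" assume L: "finite L"
  have sign: "(-1) ^ d * ecoeff f J = (-1) ^ card J * ecoeff f J" for J
  proof (cases "ecoeff f J = 0")
    case False
    with parity show ?thesis
      by (metis minus_one_power_iff)
  qed simp
  have R: "ecoeff (contract i f * g + (-1) ^ d * f * contract i g) L =
      (\<Sum>J\<in>Pow L. (-1) ^ crossings J (L - J) * ecoeff (contract i f) J * ecoeff g (L - J) +
        (-1) ^ crossings J (L - J) * ((-1) ^ d * ecoeff f J) * ecoeff (contract i g) (L - J))"
    by (simp add: ecoeff_times [of "contract i f" g] ecoeff_times [of "(-1) ^ d * f"] sum.distrib)
  show "ecoeff (contract i (f * g)) L =
      ecoeff (contract i f * g + (-1) ^ d * f * contract i g) L"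
  proof (cases "i \<in> L")
    case True
    define M where "M = L - {i}"
    have M: "finite M" "i \<notin> M" "L = insert i M"
      using L True by (auto simp: M_def)
    have "(-1) ^ crossings J (L - J) * ecoeff (contract i f) J * ecoeff g (L - J) +
        (-1) ^ crossings J (L - J) * ((-1) ^ card J * ecoeff f J) *
          ecoeff (contract i g) (L - J) +
        ((-1) ^ crossings (insert i J) (L - insert i J) * ecoeff (contract i f) (insert i J) *
          ecoeff g (L - insert i J) +
        (-1) ^ crossings (insert i J) (L - insert i J) *
          ((-1) ^ card (insert i J) * ecoeff f (insert i J)) *
          ecoeff (contract i g) (L - insert i J)) = 0" if "J \<in> Pow M" for J
    proof -
      have J: "finite J" "i \<notin> J" "L - J = insert i (M - J)" "L - insert i J = M - J"
        using that M by (auto intro: finite_subset [OF _ M(1)])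
      have "crossings J ({i} \<union> (M - J)) = crossings J {i} + crossings J (M - J)"
        using J M by (intro crossings_Un_right) auto
      then have 1: "crossings J (insert i (M - J)) + crossings {i} J =
          card J + crossings J (M - J)"
        using crossings_single_both [of J i] J by simp
      have "crossings ({i} \<union> J) (M - J) = crossings {i} (M - J) + crossings J (M - J)"
        using J M by (intro crossings_Un_left) auto
      then have 2: "crossings (insert i J) (M - J) + crossings {i} (M - J) =
          2 * crossings {i} (M - J) + crossings J (M - J)"
        by simp
      have "(-1) ^ crossings J (insert i (M - J)) * ((-1) ^ crossings {i} J * a) * b =
          (-1) ^ (card J + crossings J (M - J)) * a * b" for a b :: 'a
        unfolding 1 [symmetric] by (simp add: power_add mult_ac)
      moreover have "(-1) ^ crossings (insert i J) (M - J) * ((-1) ^ Suc (card J) * a) *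
          ((-1) ^ crossings {i} (M - J) * b) =
          (-1) ^ Suc (card J) * (-1) ^ (2 * crossings {i} (M - J) + crossings J (M - J)) * a * b"
        for a b :: 'a
        unfolding 2 [symmetric] by (simp add: power_add mult_ac)
      ultimately show ?thesis
        using J(1,2) M(2) unfolding J(3,4) ecoeff_contract
        by (simp add: power_add)
    qed
    then have "ecoeff (contract i f * g + (-1) ^ d * f * contract i g) L = 0"
      unfolding R sign by (subst (1) M(3), subst sum_Pow_insert) (use M in auto)
    with True show ?thesis
      by (simp add: ecoeff_contract)
  next
    case False
    have "ecoeff (contract i (f * g)) L =
        (\<Sum>J\<in>Pow L. (-1) ^ crossings {i} L *
          ((-1) ^ crossings J (insert i L - J) * ecoeff f J * ecoeff g (insert i L - J) +
          (-1) ^ crossings (insert i J) (insert i L - insert i J) * ecoeff f (insert i J) *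
          ecoeff g (insert i L - insert i J)))"
      using False L by (simp add: ecoeff_contract ecoeff_times sum_Pow_insert sum_distrib_left)
    also have "\<dots> = ecoeff (contract i f * g + (-1) ^ d * f * contract i g) L"
      unfolding R sign
    proof (rule sum.cong [OF refl])
      fix J assume "J \<in> Pow L"
      then have J: "finite J" "i \<notin> J" "i \<notin> L - J"
        "insert i L - J = insert i (L - J)" "insert i L - insert i J = L - J"
        using False by (auto intro: finite_subset [OF _ L])
      have "crossings {i} (J \<union> (L - J)) = crossings {i} J + crossings {i} (L - J)"
        using J L by (intro crossings_Un_right) auto
      moreover have "J \<union> (L - J) = L"
        using \<open>J \<in> Pow L\<close> by auto
      ultimately have 0: "crossings {i} L = crossings {i} J + crossings {i} (L - J)"
        by simp
      have "crossings J ({i} \<union> (L - J)) = crossings J {i} + crossings J (L - J)"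
        using J L by (intro crossings_Un_right) auto
      then have 1: "crossings {i} L + crossings J (insert i (L - J)) =
          card J + crossings J (L - J) + crossings {i} (L - J)"
        using 0 crossings_single_both [of J i] J by simp
      have "crossings ({i} \<union> J) (L - J) = crossings {i} (L - J) + crossings J (L - J)"
        using J L by (intro crossings_Un_left) auto
      then have 2: "crossings {i} L + crossings (insert i J) (L - J) =
          2 * crossings {i} (L - J) + (crossings {i} J + crossings J (L - J))"
        using 0 by simp
      have "(-1) ^ crossings {i} L * ((-1) ^ crossings J (insert i (L - J)) * a * b) =
          (-1) ^ (card J + crossings J (L - J) + crossings {i} (L - J)) * a * b" for a b :: 'a
        unfolding 1 [symmetric] by (simp add: power_add mult_ac)
      moreover have "(-1) ^ crossings {i} L * ((-1) ^ crossings (insert i J) (L - J) * a * b) =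
          (-1) ^ (2 * crossings {i} (L - J) + (crossings {i} J + crossings J (L - J))) * a * b"
        for a b :: 'a
        unfolding 2 [symmetric] by (simp add: power_add mult_ac)
      ultimately show "(-1) ^ crossings {i} L *
          ((-1) ^ crossings J (insert i L - J) * ecoeff f J * ecoeff g (insert i L - J) +
          (-1) ^ crossings (insert i J) (insert i L - insert i J) * ecoeff f (insert i J) *
          ecoeff g (insert i L - insert i J)) =
        (-1) ^ crossings J (L - J) * ecoeff (contract i f) J * ecoeff g (L - J) +
        (-1) ^ crossings J (L - J) * ((-1) ^ card J * ecoeff f J) *
          ecoeff (contract i g) (L - J)"
        unfolding J(4,5) using J(2,3)
        by (simp add: ecoeff_contract distrib_left power_add mult_ac)
    qed
    finally show ?thesis .
  qed
qed

lemma contract_PE: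
  assumes "f \<in> PE n"
  shows "contract i f \<in> PE n"
proof -
  have "ecoeff (contract i f) K \<in> polys n" for K
    using assms by (auto simp: ecoeff_contract PE_coeff)
  moreover have "K \<subseteq> {1..n}" if "ecoeff (contract i f) K \<noteq> 0" for K
  proof -
    have "ecoeff f (insert i K) \<noteq> 0"
      using that by (auto simp: ecoeff_contract split: if_splits)
    then show ?thesis
      using PE_subset [OF assms] by blast
  qed
  ultimately show ?thesis
    by (simp add: PE_def)
qed

lemma contract_PE_ext:
  assumes "f \<in> PE_ext n (Suc r)" "ecoeff (contract i f) K \<noteq> 0"
  shows "card K = r"
proof -
  have "finite K"
    using assms(2) ecoeff_infinite by blast
  moreover have "i \<notin> K" "ecoeff f (insert i K) \<noteq> 0"
    using assms(2) by (auto simp: ecoeff_contract split: if_splits)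
  moreover have "card (insert i K) = Suc r"
    using assms(1) calculation(3) by (simp add: PE_ext_def)
  ultimately show ?thesis
    by simp
qed

lemma is_milnor_contract:
  "is_milnor q n j
    (restrict (\<lambda>f. \<Sum>i\<in>{1..n}. econst (X i ^ q ^ j) * contract i f) (PE n))"
proof -
  let ?w = "\<lambda>i. X i ^ q ^ j :: 'a mpoly"
  define D where "D = restrict (\<lambda>f. \<Sum>i\<in>{1..n}. econst (?w i) * contract i f) (PE n)"
  have w: "?w i \<in> polys n" if "i \<in> {1..n}" for i
    using that by (intro polys_power polys_X)
  have D_eq: "D f = (\<Sum>i\<in>{1..n}. econst (?w i) * contract i f)" if "f \<in> PE n" for f
    using that by (simp add: D_def)
  have ext: "D \<in> extensional (PE n)"
    by (simp add: D_def)
  have 1: "D f \<in> PE_ext n r" if f: "f \<in> PE_ext n (Suc r)" for f r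
  proof -
    have PE: "f \<in> PE n"
      using f by (simp add: PE_ext_def)
    have "D f \<in> PE n"
      unfolding D_eq [OF PE] by (intro PE_sum PE_econst_mult w contract_PE PE)
    moreover have "card K = r" if nz: "ecoeff (D f) K \<noteq> 0" for K
    proof -
      have "(\<Sum>i\<in>{1..n}. ?w i * ecoeff (contract i f) K) \<noteq> 0"
        using nz unfolding D_eq [OF PE] by simp
      then obtain i where "?w i * ecoeff (contract i f) K \<noteq> 0"
        using sum.not_neutral_contains_not_neutral by blast
      then have "ecoeff (contract i f) K \<noteq> 0"
        by auto
      then show ?thesis
        by (rule contract_PE_ext [OF f])
    qed
    ultimately show ?thesis
      by (simp add: PE_ext_def)
  qed
  have 2: "D f = 0" if f: "f \<in> PE_ext n 0" for f
  proof -
    have "contract i f = 0" for i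
    proof (rule ext_eqI)
      fix K :: "nat set" assume "finite K"
      then have "ecoeff f (insert i K) = 0"
        using f card_insert_disjoint card_0_eq [of "insert i K"] by (auto simp: PE_ext_def)
      then show "ecoeff (contract i f) K = ecoeff 0 K"
        by (simp add: ecoeff_contract)
    qed
    moreover have "f \<in> PE n"
      using f by (simp add: PE_ext_def)
    ultimately show ?thesis
      by (simp add: D_eq)
  qed
  have 3: "D (f + g) = D f + D g" if "f \<in> PE n" "g \<in> PE n" for f g
    using that PE_add [OF that] by (simp add: D_eq contract_plus distrib_left sum.distrib)
  have 4: "D (econst c * f) = econst c * D f" if "c \<in> polys n" "f \<in> PE n" for c f
  proof -
    have "econst (?w i) * (econst c * contract i f) = econst c * (econst (?w i) * contract i f)" for i
      by (rule ext_eqI) (simp add: mult_ac)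
    then show ?thesis
      using that PE_econst_mult [OF that] by (simp add: D_eq contract_econst_mult sum_distrib_left)
  qed
  have 5: "D (f * g) = D f * g + (-1) ^ d * f * D g"
    if f: "f \<in> PE_deg n d" and g: "g \<in> PE n" for d f g
  proof -
    have f': "f \<in> PE n"
      using f by (simp add: PE_deg_def)
    have "econst (?w i) * contract i (f * g) =
        econst (?w i) * contract i f * g + (-1) ^ d * f * (econst (?w i) * contract i g)" for i
    proof -
      have "(-1) ^ d * f * (econst (?w i) * contract i g) =
          ((-1) ^ d * f * econst (?w i)) * contract i g"
        by (rule mult.assoc [symmetric])
      also have "\<dots> = (econst (?w i) * ((-1) ^ d * f)) * contract i g"
        by (simp only: econst_commute [of "?w i" "(-1) ^ d * f"])
      also have "\<dots> = econst (?w i) * ((-1) ^ d * f * contract i g)"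
        by (rule mult.assoc)
      finally have "(-1) ^ d * f * (econst (?w i) * contract i g) =
          econst (?w i) * ((-1) ^ d * f * contract i g)" .
      then show ?thesis
        using contract_mult [of f d i g] PE_deg_parity [OF f]
        by (simp add: distrib_left mult.assoc)
    qed
    then show ?thesis
      using f' g PE_mult [OF f' g] by (simp add: D_eq sum.distrib sum_distrib_left sum_distrib_right)
  qed
  have 6: "D (dX i) = econst (X i ^ q ^ j)" if "i \<in> {1..n}" for i
  proof -
    have "dX i \<in> PE n"
      using that by (auto simp: dX_def)
    then have "D (dX i) = (\<Sum>k\<in>{1..n}. if k = i then econst (?w k) else 0)"
      unfolding D_eq [OF \<open>dX i \<in> PE n\<close>]
      by (intro sum.cong refl) (simp add: dX_def contract_generator)
    then show ?thesis
      using that by simp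
  qed
  have 7: "D (econst (X i)) = 0" if "i \<in> {1..n}" for i
    using that by (simp add: D_eq PE_econst contract_econst)
  have "is_milnor q n j D"
    unfolding is_milnor_def
    by (intro conjI allI ballI;
        (rule ext | erule 1 | erule 2 | rule 3, assumption+ | rule 4, assumption+ |
         rule 5, assumption+ | erule 6 | erule 7))
  then show ?thesis
    by (simp only: D_def)
qed

lemma is_milnor_unique:
  assumes D: "is_milnor q n j D" and D': "is_milnor q n j (D' :: 'a::comm_ring_1 form \<Rightarrow> 'a form)"
  shows "D = D'"
proof (rule extensionalityI)
  show "D \<in> extensional (PE n)" "D' \<in> extensional (PE n)"
    using D D' by (auto simp: is_milnor_def)
  have expand: "E f = (\<Sum>J\<in>Pow {1..n}. econst (ecoeff f J) * E (ebasis J))"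
    if E: "is_milnor q n j E" and f: "f \<in> PE n" for E :: "'a form \<Rightarrow> 'a form" and f
  proof -
    have add: "E (a + b) = E a + E b" if "a \<in> PE n" "b \<in> PE n" for a b
      using E that by (simp add: is_milnor_def)
    have lin: "E (econst c * a) = econst c * E a" if "c \<in> polys n" "a \<in> PE n" for c a
      using E that by (simp add: is_milnor_def)
    have zero: "E 0 = 0"
      using add [of 0 0] by simp
    have sum: "E (sum h A) = (\<Sum>J\<in>A. E (h J))" if "\<And>J. J \<in> A \<Longrightarrow> h J \<in> PE n"
      for A and h :: "nat set \<Rightarrow> 'a form"
      using that by (induction A rule: infinite_finite_induct) (auto simp: zero add PE_sum)
    have "f = (\<Sum>J\<in>Pow {1..n}. econst (ecoeff f J) * ebasis J)"
      using PE_subset [OF f] by (intro ext_expand) auto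
    then have "E f = E (\<Sum>J\<in>Pow {1..n}. econst (ecoeff f J) * ebasis J)"
      by simp
    also have "\<dots> = (\<Sum>J\<in>Pow {1..n}. E (econst (ecoeff f J) * ebasis J))"
      using f by (intro sum PE_econst_mult PE_coeff PE_ebasis) auto
    also have "\<dots> = (\<Sum>J\<in>Pow {1..n}. econst (ecoeff f J) * E (ebasis J))"
      using f by (intro sum.cong refl lin PE_coeff PE_ebasis) auto
    finally show ?thesis .
  qed
  have basis: "D (ebasis J) = D' (ebasis J)" if "J \<subseteq> {1..n}" for J
  proof -
    have "finite J"
      using that by (rule finite_subset) simp
    then show ?thesis
      using that
    proof (induction J rule: finite_linorder_min_induct)
      case empty
      have "1 \<in> PE_ext n 0"
        by (auto simp: PE_ext_def PE_def ecoeff_one)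
      then have "E 1 = 0" if "is_milnor q n j E" for E :: "'a form \<Rightarrow> 'a form"
        using that unfolding is_milnor_def by blast
      from this [OF D] this [OF D'] show ?case
        by (simp add: ebasis_empty)
    next
      case (insert b A)
      have "{k \<in> A. k < b} = {}"
        using insert.hyps by auto
      then have "crossings {b} A = 0"
        by (simp add: crossings_single_left)
      moreover have "b \<notin> A"
        using insert.hyps by auto
      ultimately have eq: "ebasis (insert b A) = (dX b * ebasis A :: 'a form)"
        using insert.hyps by (simp add: dX_def ebasis_mult)
      have b: "b \<in> {1..n}" "dX b \<in> PE_deg n 1" "ebasis A \<in> PE n"
        using insert.prems by (blast intro: dX_deg PE_ebasis)+
      have step: "E (dX b * ebasis A) =
          econst (X b ^ q ^ j) * ebasis A + (-1) ^ 1 * dX b * E (ebasis A)"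
        if "is_milnor q n j E" for E :: "'a form \<Rightarrow> 'a form"
        using that b unfolding is_milnor_def by metis
      show ?case
        unfolding eq using step [OF D] step [OF D'] insert by simp
    qed
  qed
  fix f :: "'a form" assume "f \<in> PE n"
  then show "D f = D' f"
    using basis by (simp add: expand [OF D] expand [OF D'])
qed

lemma is_milnor_milnor:
  "is_milnor q n j (milnor q n j :: 'a::comm_ring_1 form \<Rightarrow> 'a form)"
  unfolding milnor_def
proof (rule theI [where P = "is_milnor q n j"])
  show "is_milnor q n j
      (restrict (\<lambda>f :: 'a form. \<Sum>i\<in>{1..n}. econst (X i ^ q ^ j) * contract i f) (PE n))"
    by (rule is_milnor_contract)
qed (rule is_milnor_unique [OF _ is_milnor_contract])


section \<open>Dickson and Mui invariants\<close>

definition dickson :: "nat \<Rightarrow> nat \<Rightarrow> (nat \<Rightarrow> nat) \<Rightarrow> (nat \<Rightarrow> 'b) \<Rightarrow> 'b::comm_ring_1" where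
  "dickson q k i y =
    (\<Sum>\<sigma> | \<sigma> permutes {1..k}. of_int (sign \<sigma>) * (\<Prod>l=1..k. y (\<sigma> l) ^ q ^ i l))"

text \<open>
  \<open>shuffle n J\<close> sends \<open>1, \<dots>, card J\<close> increasingly onto \<open>J\<close> and \<open>card J + 1, \<dots>, n\<close>
  increasingly onto the complement of \<open>J\<close>.
\<close>

definition shuffle :: "nat \<Rightarrow> nat set \<Rightarrow> nat \<Rightarrow> nat" where
  "shuffle n J k =
    (if k \<in> {1..n} then (sorted_list_of_set J @ sorted_list_of_set ({1..n} - J)) ! (k - 1)
     else k)"

definition mui :: "nat \<Rightarrow> nat \<Rightarrow> nat \<Rightarrow> (nat \<Rightarrow> nat) \<Rightarrow> 'a::comm_ring_1 form" where
  "mui q n r i =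
    (\<Sum>J | J \<subseteq> {1..n} \<and> card J = r.
      of_int (sign (shuffle n J)) * (\<Prod>k\<leftarrow>[1..<r + 1]. dX (shuffle n J k)) *
      econst (dickson q (n - r) i (\<lambda>l. X (shuffle n J (r + l)))))"

lemma shuffle_permutes:
  assumes "J \<subseteq> {1..n}"
  shows "shuffle n J permutes {1..n}"
proof (rule bij_imp_permutes)
  let ?js = "sorted_list_of_set J @ sorted_list_of_set ({1..n} - J)"
  have fin: "finite J"
    using assms by (rule finite_subset) simp
  have set: "set ?js = {1..n}"
    using assms fin by auto
  have dist: "distinct ?js"
    using fin by auto
  have len: "length ?js = n"
    using distinct_card [OF dist] set by simp
  have "bij_betw ((!) ?js) {..<n} {1..n}"
    using bij_betw_nth [OF dist, of "{..<n}" "{1..n}"] len set by simp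
  moreover have "bij_betw (\<lambda>k. k - 1) {1..n} {..<n}"
    by (rule bij_betw_byWitness [of _ Suc]) auto
  ultimately have "bij_betw ((!) ?js \<circ> (\<lambda>k. k - 1)) {1..n} {1..n}"
    by (rule bij_betw_trans [rotated])
  then show "bij_betw (shuffle n J) {1..n} {1..n}"
    by (rule bij_betw_cong [THEN iffD1, rotated]) (simp add: shuffle_def)
qed (auto simp: shuffle_def)

end

theory Submission
  imports Defs "Jordan_Normal_Form.Determinant"
begin

text \<open>
  Write \<open>C\<close> for the complement of \<open>J\<close> in \<open>{1..n}\<close>. Applying one more Milnor operation to a form
  whose coefficients at \<open>J\<close> are the determinants of \<open>x\<^sub>c ^ q ^ j\<^sub>l\<close> with \<open>c \<in> C\<close> is a Laplace
  expansion along a new row: the last one if the operations are applied in the order of the rows,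
  the first one if they are applied in the opposite order. The sign left over is
  \<open>(-1) ^ crossings C J\<close>, whereas the shuffle of \<open>J\<close> has sign \<open>(-1) ^ crossings J C\<close>; the two
  exponents add up to \<open>card J * card C = r * (n - r)\<close>.
\<close>

section \<open>Milnor operations in coordinates\<close>

text \<open>Uniqueness identifies the operator given by description with the explicit one that
  witnesses existence.\<close>

lemma milnor_eq:
  fixes f :: "'a::comm_ring_1 form"
  assumes "f \<in> PE n"
  shows "milnor q n j f = (\<Sum>i\<in>{1..n}. econst (X i ^ q ^ j) * contract i f)"
proof -
  have "milnor q n j =
      restrict (\<lambda>f :: 'a form. \<Sum>i\<in>{1..n}. econst (X i ^ q ^ j) * contract i f) (PE n)"
    by (rule is_milnor_unique [OF is_milnor_milnor is_milnor_contract])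
  then show ?thesis
    using assms by simp
qed

text \<open>Contraction by \<open>c\<close> has no coefficient at a set containing \<open>c\<close>,
  so only the complement of \<open>J\<close> contributes. All later computations with Milnor
  operations go through this formula.\<close>

lemma ecoeff_milnor:
  assumes "f \<in> PE n"
  shows "ecoeff (milnor q n j f) J =
    (\<Sum>c\<in>{1..n} - J. (-1) ^ crossings {c} J * X c ^ q ^ j * ecoeff f (insert c J))"
proof -
  have "ecoeff (milnor q n j f) J = (\<Sum>c\<in>{1..n}. X c ^ q ^ j * ecoeff (contract c f) J)"
    using assms by (simp add: milnor_eq)
  also have "\<dots> = (\<Sum>c\<in>{1..n} - J. X c ^ q ^ j * ecoeff (contract c f) J)"
    by (rule sum.mono_neutral_right) (auto simp: ecoeff_contract)
  also have "\<dots> = (\<Sum>c\<in>{1..n} - J. (-1) ^ crossings {c} J * X c ^ q ^ j * ecoeff f (insert c J))"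
    by (intro sum.cong refl) (simp add: ecoeff_contract mult_ac)
  finally show ?thesis .
qed

lemma milnor_PE_ext: "f \<in> PE_ext n (Suc r) \<Longrightarrow> milnor q n j f \<in> PE_ext n r"
  using is_milnor_milnor [of q n j] unfolding is_milnor_def by blast

lemma fold_milnor_PE_ext:
  "f \<in> PE_ext n (length js + r) \<Longrightarrow> fold (milnor q n) js f \<in> PE_ext n r"
  by (induction js arbitrary: f) (auto intro: milnor_PE_ext)

lemma foldr_milnor_PE_ext:
  "f \<in> PE_ext n (length js + r) \<Longrightarrow> foldr (milnor q n) js f \<in> PE_ext n r"
  using fold_milnor_PE_ext [of f n "rev js" r q] by (simp add: foldr_conv_fold)

lemma PE_ext_sign_mult: "f \<in> PE_ext n r \<Longrightarrow> (-1) ^ k * f \<in> PE_ext n r"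
  by (cases "even k") (auto simp: PE_ext_def PE_def)

text \<open>A form of exterior degree \<open>r\<close> is supported on the \<open>r\<close>-element
  subsets of \<open>{1..n}\<close>. The case distinction has the shape in which the coefficients of
  the Mui invariant are computed below.\<close>

lemma PE_ext_eqI:
  assumes "f \<in> PE_ext n r"
    and "\<And>J. ecoeff g J = (if J \<subseteq> {1..n} \<and> card J = r then ecoeff f J else 0)"
  shows "g = f"
proof (rule ext_eqI)
  fix J :: "nat set"
  have "ecoeff f J = 0" if "\<not> (J \<subseteq> {1..n} \<and> card J = r)"
    using assms(1) that by (auto simp: PE_ext_def PE_def)
  then show "ecoeff g J = ecoeff f J"
    using assms(2) [of J] by auto
qed

lemma ebasis_PE_ext: "r = n \<Longrightarrow> ebasis {1..n} \<in> PE_ext n r"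
  by (auto simp: PE_ext_def ecoeff_ebasis split: if_splits)

text \<open>The head is smaller than all later entries, so multiplying by it creates no crossing and
  hence no sign.\<close>

lemma prod_list_dX_sorted:
  "sorted_wrt (<) xs \<Longrightarrow> (\<Prod>k\<leftarrow>xs. dX k) = (ebasis (set xs) :: 'a::comm_ring_1 form)"
proof (induction xs)
  case (Cons x xs)
  have "crossings {x} (set xs) = 0"
    using Cons.prems by (auto simp: crossings_single_left)
  moreover have "x \<notin> set xs"
    using Cons.prems by auto
  ultimately show ?case
    using Cons by (simp add: dX_def ebasis_mult)
qed (simp add: ebasis_empty)


section \<open>Moore determinants\<close>

text \<open>Moore determinant with arbitrary exponents: rows belong to \<open>js\<close>, columns to
  the variables listed in \<open>cs\<close>. With lists, applying one more operation adds an entry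
  to \<open>js\<close>, and moving a variable into \<open>J\<close> deletes one from
  \<open>cs\<close>.\<close>

definition moore :: "nat \<Rightarrow> nat list \<Rightarrow> nat list \<Rightarrow> 'a::comm_ring_1 mpoly" where
  "moore q js cs =
    det (mat (length js) (length js) (\<lambda>(l, m). X (cs ! m) ^ q ^ (js ! l)))"

lemma moore_Nil [simp]: "moore q [] cs = 1"
  by (simp add: moore_def)

text \<open>The right-hand side is the index shift by which \<open>mat_delete\<close> skips a
  column.\<close>

lemma nth_take_drop_Suc:
  assumes "m < length xs" "k < length xs - 1"
  shows "(take m xs @ drop (Suc m) xs) ! k = xs ! (if k < m then k else Suc k)"
  using assms by (auto simp: nth_append)

text \<open>Laplace expansion along the first row.\<close>

lemma moore_Cons:
  assumes "length cs = Suc (length js)"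
  shows "moore q (j # js) cs = (\<Sum>m<Suc (length js).
    (-1) ^ m * X (cs ! m) ^ q ^ j * moore q js (take m cs @ drop (Suc m) cs))"
proof -
  let ?k = "length js"
  let ?A = "mat (Suc ?k) (Suc ?k) (\<lambda>(l, m). X (cs ! m) ^ q ^ ((j # js) ! l)) :: 'a mpoly mat"
  have "moore q (j # js) cs = (\<Sum>m<Suc ?k. ?A $$ (0, m) * cofactor ?A 0 m)"
    unfolding moore_def by (simp add: laplace_expansion_row [of _ "Suc ?k" 0])
  also have "\<dots> = (\<Sum>m<Suc ?k.
      (-1) ^ m * X (cs ! m) ^ q ^ j * moore q js (take m cs @ drop (Suc m) cs))"
  proof (intro sum.cong refl)
    fix m assume m: "m \<in> {..<Suc ?k}"
    have "mat_delete ?A 0 m =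
        mat ?k ?k (\<lambda>(l, i). X ((take m cs @ drop (Suc m) cs) ! i) ^ q ^ (js ! l))"
      using m assms
      by (intro eq_matI) (auto simp: mat_delete_def nth_take_drop_Suc simp del: upt_Suc)
    then show "?A $$ (0, m) * cofactor ?A 0 m =
        (-1) ^ m * X (cs ! m) ^ q ^ j * moore q js (take m cs @ drop (Suc m) cs)"
      using m by (simp add: cofactor_def moore_def mult_ac)
  qed
  finally show ?thesis .
qed

text \<open>Laplace expansion along the last row, whose index is \<open>length js\<close>; this is
  the source of the extra sign.\<close>

lemma moore_snoc:
  assumes "length cs = Suc (length js)"
  shows "moore q (js @ [j]) cs = (\<Sum>m<Suc (length js).
    (-1) ^ (length js + m) * X (cs ! m) ^ q ^ j * moore q js (take m cs @ drop (Suc m) cs))"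
proof -
  let ?k = "length js"
  let ?A = "mat (Suc ?k) (Suc ?k) (\<lambda>(l, m). X (cs ! m) ^ q ^ ((js @ [j]) ! l)) :: 'a mpoly mat"
  have "moore q (js @ [j]) cs = (\<Sum>m<Suc ?k. ?A $$ (?k, m) * cofactor ?A ?k m)"
    unfolding moore_def by (simp add: laplace_expansion_row [of _ "Suc ?k" ?k])
  also have "\<dots> = (\<Sum>m<Suc ?k.
      (-1) ^ (?k + m) * X (cs ! m) ^ q ^ j * moore q js (take m cs @ drop (Suc m) cs))"
  proof (intro sum.cong refl)
    fix m assume m: "m \<in> {..<Suc ?k}"
    have "mat_delete ?A ?k m =
        mat ?k ?k (\<lambda>(l, i). X ((take m cs @ drop (Suc m) cs) ! i) ^ q ^ (js ! l))"
      using m assms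
      by (intro eq_matI) (auto simp: mat_delete_def nth_take_drop_Suc nth_append)
    then show "?A $$ (?k, m) * cofactor ?A ?k m =
        (-1) ^ (?k + m) * X (cs ! m) ^ q ^ j * moore q js (take m cs @ drop (Suc m) cs)"
      using m by (simp add: cofactor_def moore_def mult_ac)
  qed
  finally show ?thesis .
qed

text \<open>Both sides are Leibniz sums, over permutations of \<open>{1..k}\<close> and of
  \<open>{0..<k}\<close>. Conjugation by the shift \<open>Suc\<close> matches them and preserves
  signs.\<close>

lemma dickson_det:
  "dickson q k i y = det (mat k k (\<lambda>(l, m). y (Suc m) ^ q ^ i (Suc l)))"
proof -
  let ?S = "map_permutation {0..<k} Suc" and ?P = "map_permutation {1..k} (\<lambda>x. x - 1)"
  have S: "bij_betw Suc {0..<k} {1..k}"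
    by (rule bij_betw_byWitness [of _ "\<lambda>x. x - 1"]) auto
  have P: "bij_betw (\<lambda>x. x - 1) {1..k} {0..<k}"
    by (rule bij_betw_byWitness [of _ Suc]) auto
  have "det (mat k k (\<lambda>(l, m). y (Suc m) ^ q ^ i (Suc l))) =
      (\<Sum>\<sigma> | \<sigma> permutes {0..<k}. of_int (sign \<sigma>) * (\<Prod>l=0..<k. y (Suc (\<sigma> l)) ^ q ^ i (Suc l)))"
    \<comment> \<open>A matrix entry can be evaluated only inside the index range, so
      \<open>\<sigma> l < k\<close> is required.\<close>
    using permutes_in_image [of _ "{0..<k}"]
    by (subst det_def' [of _ k])
       (auto intro!: sum.cong prod.cong arg_cong2 [of _ _ _ _ "(*)"])
  also have "\<dots> = dickson q k i y"
    unfolding dickson_def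
  proof (rule sum.reindex_bij_witness [of _ ?P ?S], goal_cases)
    case (1 \<sigma>) then show ?case by (intro map_permutation_compose_inv [OF S]) auto
  next
    case (2 \<sigma>) then show ?case using map_permutation_permutes [OF S] by auto
  next
    case (3 \<sigma>) then show ?case by (intro map_permutation_compose_inv [OF P]) auto
  next
    case (4 \<sigma>) then show ?case using map_permutation_permutes [OF P] by auto
  next
    case (5 \<sigma>)
    have "(\<Prod>l=1..k. y (?S \<sigma> l) ^ q ^ i l) = (\<Prod>l=0..<k. y (?S \<sigma> (Suc l)) ^ q ^ i (Suc l))"
      by (rule prod.reindex_bij_betw [OF S, symmetric])
    also have "\<dots> = (\<Prod>l=0..<k. y (Suc (\<sigma> l)) ^ q ^ i (Suc l))"
      by (intro prod.cong refl) (simp add: map_permutation_apply)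
    finally show ?case
      using 5 by (simp add: sign_map_permutation)
  qed
  finally show ?thesis by simp
qed


section \<open>Iterated Milnor operations on the volume form\<close>

text \<open>Translates removing an element from the complement of \<open>J\<close> into deleting a
  column of the Moore matrix.\<close>

lemma sorted_list_of_set_Diff_nth:
  assumes "finite C" "m < card C"
  shows "sorted_list_of_set (C - {sorted_list_of_set C ! m}) =
    take m (sorted_list_of_set C) @ drop (Suc m) (sorted_list_of_set C)"
proof -
  let ?cs = "sorted_list_of_set C"
  have m: "m < length ?cs"
    using assms by simp
  have *: "?cs = take m ?cs @ ?cs ! m # drop (Suc m) ?cs"
    using m by (rule id_take_nth_drop)
  then have "distinct (take m ?cs @ ?cs ! m # drop (Suc m) ?cs)"
    by (metis distinct_sorted_list_of_set)
  then have "remove1 (?cs ! m) (take m ?cs @ ?cs ! m # drop (Suc m) ?cs) =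
      take m ?cs @ drop (Suc m) ?cs"
    by (simp add: remove1_append)
  then show ?thesis
    using * assms by (simp add: sorted_list_of_set_remove)
qed

lemma card_greater_nth_sorted_list_of_set:
  fixes C :: "nat set"
  assumes "finite C" "m < card C"
  shows "card {c \<in> C. sorted_list_of_set C ! m < c} = card C - Suc m"
proof -
  let ?cs = "sorted_list_of_set C"
  have len: "length ?cs = card C" and set: "set ?cs = C"
    using assms by simp_all
  have mono: "?cs ! a < ?cs ! b \<longleftrightarrow> a < b" if "a < card C" "b < card C" for a b
    using that len sorted_wrt_nth_less [OF strict_sorted_list_of_set [of C], of a b]
      sorted_wrt_nth_less [OF strict_sorted_list_of_set [of C], of b a]
    by (cases a b rule: linorder_cases) auto
  have "{c \<in> C. ?cs ! m < c} = (!) ?cs ` {Suc m..<card C}"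
  proof (intro equalityI subsetI)
    fix c assume "c \<in> {c \<in> C. ?cs ! m < c}"
    then obtain k where "k < card C" "c = ?cs ! k" "?cs ! m < ?cs ! k"
      using set len by (metis (no_types, lifting) in_set_conv_nth mem_Collect_eq)
    then show "c \<in> (!) ?cs ` {Suc m..<card C}"
      using mono [of m k] assms by auto
  next
    fix c assume "c \<in> (!) ?cs ` {Suc m..<card C}"
    then obtain k where "k < card C" "c = ?cs ! k" "m < k"
      by auto
    then show "c \<in> {c \<in> C. ?cs ! m < c}"
      using mono [of m k] assms set len nth_mem [of k ?cs] by auto
  qed
  moreover have "inj_on ((!) ?cs) {Suc m..<card C}"
    using len by (intro inj_on_nth) auto
  ultimately show ?thesis
    by (simp add: card_image)
qed

text \<open>The inductive step common to both orders of composition. The exponent \<open>e\<close>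
  carries the sign accumulated so far, and the sum is left unevaluated because it is an expansion
  along the last row, or along the first row up to a global sign.\<close>

lemma ecoeff_milnor_step:
  fixes f :: "'a::comm_ring_1 form"
  assumes f: "f \<in> PE n"
    and J: "J \<subseteq> {1..n}" "card J + Suc (length js) = n"
    and coeff: "\<And>L. L \<subseteq> {1..n} \<Longrightarrow> card L + length js = n \<Longrightarrow>
      ecoeff f L = (-1) ^ (e + crossings ({1..n} - L) L) *
        moore q js (sorted_list_of_set ({1..n} - L))"
  defines "cs \<equiv> sorted_list_of_set ({1..n} - J)"
  shows "ecoeff (milnor q n j f) J = (-1) ^ (e + crossings ({1..n} - J) J) *
    (\<Sum>m<Suc (length js). (-1) ^ (length js + m) * X (cs ! m) ^ q ^ j *
      moore q js (take m cs @ drop (Suc m) cs))"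
proof -
  let ?C = "{1..n} - J" and ?k = "length js"
  have finJ: "finite J"
    using J(1) by (rule finite_subset) simp
  have card: "card ?C = Suc ?k"
    using J finJ by (simp add: card_Diff_subset)
  have bij: "bij_betw ((!) cs) {..<Suc ?k} ?C"
    using card by (intro bij_betw_nth) (auto simp: cs_def)
  have "ecoeff (milnor q n j f) J =
      (\<Sum>c\<in>?C. (-1) ^ crossings {c} J * X c ^ q ^ j * ecoeff f (insert c J))"
    by (rule ecoeff_milnor [OF f])
  also have "\<dots> = (\<Sum>m<Suc ?k. (-1) ^ crossings {cs ! m} J * X (cs ! m) ^ q ^ j *
      ecoeff f (insert (cs ! m) J))"
    by (rule sum.reindex_bij_betw [OF bij, symmetric])
  also have "\<dots> = (\<Sum>m<Suc ?k. (-1) ^ (e + crossings ?C J) * ((-1) ^ (?k + m) *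
      X (cs ! m) ^ q ^ j * moore q js (take m cs @ drop (Suc m) cs)))"
  proof (intro sum.cong refl)
    fix m assume "m \<in> {..<Suc ?k}"
    then have m: "m < Suc ?k" by simp
    let ?c = "cs ! m" let ?C' = "?C - {?c}"
    have c: "?c \<in> ?C"
      using bij m by (auto simp: bij_betw_def)
    have C': "{1..n} - insert ?c J = ?C'"
      by blast
    have cs': "sorted_list_of_set ?C' = take m cs @ drop (Suc m) cs"
      unfolding cs_def using m card by (intro sorted_list_of_set_Diff_nth) auto
    have "crossings ({?c} \<union> ?C') J = crossings {?c} J + crossings ?C' J"
      using finJ by (intro crossings_Un_left) auto
    moreover have "{?c} \<union> ?C' = ?C"
      using c by blast
    moreover have "crossings ?C' (J \<union> {?c}) = crossings ?C' J + crossings ?C' {?c}"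
      using finJ c by (intro crossings_Un_right) auto
    \<comment> \<open>\<open>?C\<close> has \<open>?k + 1\<close> elements and \<open>m\<close>
      counts from 0, so \<open>?k - m\<close> of them exceed \<open>?c\<close>.\<close>
    moreover have "crossings ?C' {?c} = ?k - m"
    proof -
      have "{j \<in> ?C'. ?c < j} = {j \<in> ?C. ?c < j}"
        by blast
      then show ?thesis
        using card_greater_nth_sorted_list_of_set [of ?C m] m card
        by (simp add: crossings_single_right cs_def)
    qed
    ultimately have "crossings {?c} J + crossings ?C' (insert ?c J) = crossings ?C J + (?k - m)"
      by simp
    \<comment> \<open>Since \<open>m \<le> ?k\<close>, the truncated difference
      \<open>?k - m\<close> has the parity of \<open>?k + m\<close>, the exponent of a cofactor in
      the last row.\<close>
    then have "even (crossings {?c} J + (e + crossings ?C' (insert ?c J))) \<longleftrightarrow>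
        even (e + crossings ?C J + (?k + m))"
      using m by presburger
    then have sign: "(-1) ^ crossings {?c} J * (-1) ^ (e + crossings ?C' (insert ?c J)) =
        ((-1) ^ (e + crossings ?C J) * (-1) ^ (?k + m) :: 'a mpoly)"
      unfolding power_add [symmetric] by (simp only: minus_one_power_iff)
    have "ecoeff f (insert ?c J) = (-1) ^ (e + crossings ?C' (insert ?c J)) *
        moore q js (take m cs @ drop (Suc m) cs)"
      using coeff [of "insert ?c J"] J finJ c unfolding C' cs' by simp
    then have "(-1) ^ crossings {?c} J * X ?c ^ q ^ j * ecoeff f (insert ?c J) =
        ((-1) ^ crossings {?c} J * (-1) ^ (e + crossings ?C' (insert ?c J))) *
        (X ?c ^ q ^ j * moore q js (take m cs @ drop (Suc m) cs))"
      by (simp only: mult_ac)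
    then show "(-1) ^ crossings {?c} J * X ?c ^ q ^ j * ecoeff f (insert ?c J) =
        (-1) ^ (e + crossings ?C J) * ((-1) ^ (?k + m) * X ?c ^ q ^ j *
          moore q js (take m cs @ drop (Suc m) cs))"
      unfolding sign by (simp only: mult_ac)
  qed
  finally show ?thesis
    by (simp only: sum_distrib_left)
qed

text \<open>\<open>fold\<close> applies the last entry of the list last, so the induction appends at
  the end. Each step is then exactly an expansion along the last row, and no sign accumulates:
  \<open>e = 0\<close>.\<close>

lemma ecoeff_fold_milnor:
  assumes "J \<subseteq> {1..n}" "card J + length js = n"
  shows "ecoeff (fold (milnor q n) js (ebasis {1..n})) J =
    (-1) ^ crossings ({1..n} - J) J *
      (moore q js (sorted_list_of_set ({1..n} - J)) :: 'a::comm_ring_1 mpoly)"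
  using assms
proof (induction js arbitrary: J rule: rev_induct)
  case Nil
  then have "J = {1..n}"
    by (intro card_subset_eq) auto
  then show ?case
    by (simp add: ecoeff_ebasis)
next
  case (snoc j js)
  let ?f = "fold (milnor q n) js (ebasis {1..n}) :: 'a form"
  let ?cs = "sorted_list_of_set ({1..n} - J)"
  have "?f \<in> PE_ext n (Suc (card J))"
    using snoc.prems by (intro fold_milnor_PE_ext ebasis_PE_ext) simp
  then have f: "?f \<in> PE n"
    by (simp add: PE_ext_def)
  have "card ({1..n} - J) = Suc (length js)"
    using snoc.prems by (simp add: card_Diff_subset finite_subset [OF snoc.prems(1)])
  then have "moore q (js @ [j]) ?cs =
      (\<Sum>m<Suc (length js). (-1) ^ (length js + m) *
        X (?cs ! m) ^ q ^ j * (moore q js (take m ?cs @ drop (Suc m) ?cs) :: 'a mpoly))"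
    by (intro moore_snoc) simp
  then show ?case
    using ecoeff_milnor_step [OF f snoc.prems(1), of js 0 q j] snoc by simp
qed

text \<open>\<open>foldr\<close> applies the head last, so the new row is the first one. With
  \<open>k\<close> operations already applied, passing from last-row to first-row signs costs
  \<open>(-1) ^ k\<close>; summing these exponents gives the triangular number.\<close>

lemma ecoeff_foldr_milnor:
  assumes "J \<subseteq> {1..n}" "card J + length js = n"
  shows "ecoeff (foldr (milnor q n) js (ebasis {1..n})) J =
    (-1) ^ (length js * (length js - 1) div 2 + crossings ({1..n} - J) J) *
      (moore q js (sorted_list_of_set ({1..n} - J)) :: 'a::comm_ring_1 mpoly)"
  using assms
proof (induction js arbitrary: J)
  case Nil
  then have "J = {1..n}"
    by (intro card_subset_eq) auto
  then show ?case
    by (simp add: ecoeff_ebasis)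
next
  case (Cons j js)
  let ?f = "foldr (milnor q n) js (ebasis {1..n}) :: 'a form" and ?k = "length js"
  let ?cs = "sorted_list_of_set ({1..n} - J)"
  define e where "e = ?k * (?k - 1) div 2"
  have e: "Suc ?k * ?k div 2 = e + ?k"
  proof -
    \<comment> \<open>The case distinction takes care of the truncated \<open>?k - 1\<close> at
      \<open>?k = 0\<close>; a multiple of 2 then splits off under \<open>div\<close>.\<close>
    have "Suc ?k * ?k = ?k * (?k - 1) + ?k * 2"
      by (cases ?k) simp_all
    then show ?thesis
      unfolding e_def by simp
  qed
  have "?f \<in> PE_ext n (Suc (card J))"
    using Cons.prems by (intro foldr_milnor_PE_ext ebasis_PE_ext) simp
  then have f: "?f \<in> PE n"
    by (simp add: PE_ext_def)
  have "card ({1..n} - J) = Suc ?k"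
    using Cons.prems by (simp add: card_Diff_subset finite_subset [OF Cons.prems(1)])
  then have "moore q (j # js) ?cs = (\<Sum>m<Suc ?k. (-1) ^ m * X (?cs ! m) ^ q ^ j *
      (moore q js (take m ?cs @ drop (Suc m) ?cs) :: 'a mpoly))"
    by (intro moore_Cons) simp
  then have "(\<Sum>m<Suc ?k. (-1) ^ (?k + m) * X (?cs ! m) ^ q ^ j *
      (moore q js (take m ?cs @ drop (Suc m) ?cs) :: 'a mpoly)) =
      (-1) ^ ?k * moore q (j # js) ?cs"
    by (simp only: sum_distrib_left power_add mult.assoc)
  moreover have "ecoeff (milnor q n j ?f) J = (-1) ^ (e + crossings ({1..n} - J) J) *
    (\<Sum>m<Suc ?k. (-1) ^ (?k + m) * X (?cs ! m) ^ q ^ j *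
      moore q js (take m ?cs @ drop (Suc m) ?cs))"
    using Cons by (intro ecoeff_milnor_step [OF f Cons.prems(1)]) (simp_all add: e_def)
  ultimately show ?case
    using e by (simp add: power_add mult_ac)
qed


section \<open>The sign of a shuffle\<close>

lemma shuffle_nth:
  assumes "J \<subseteq> {1..n}"
  shows "m < card J \<Longrightarrow> shuffle n J (Suc m) = sorted_list_of_set J ! m"
    and "m < n - card J \<Longrightarrow>
      shuffle n J (card J + Suc m) = sorted_list_of_set ({1..n} - J) ! m"
proof -
  have "finite J" "card J \<le> n"
    using assms finite_subset card_mono [OF _ assms] by auto
  then show "m < card J \<Longrightarrow> shuffle n J (Suc m) = sorted_list_of_set J ! m"
    and "m < n - card J \<Longrightarrow>
      shuffle n J (card J + Suc m) = sorted_list_of_set ({1..n} - J) ! m"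
    by (auto simp: shuffle_def nth_append)
qed

text \<open>Used for an adjacent transposition, which is increasing on each block of a
  shuffle.\<close>

lemma sorted_list_of_set_image_strict_mono:
  assumes "finite A" "strict_mono_on A t"
  shows "sorted_list_of_set (t ` A) = map t (sorted_list_of_set A)"
proof (rule sorted_distinct_set_unique)
  have "sorted_wrt (\<lambda>x y. t x < t y) (sorted_list_of_set A)"
    using assms
    by (intro sorted_wrt_mono_rel [OF _ strict_sorted_list_of_set]) (auto simp: strict_mono_on_def)
  then have "sorted_wrt (<) (map t (sorted_list_of_set A))"
    by (simp add: sorted_wrt_map)
  then show "sorted (map t (sorted_list_of_set A))" "distinct (map t (sorted_list_of_set A))"
    by (simp_all add: strict_sorted_iff)
qed (use assms in auto)

lemma sign_shuffle:
  assumes "J \<subseteq> {1..n}"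
  shows "sign (shuffle n J) = (-1) ^ crossings J ({1..n} - J)"
  using assms
  \<comment> \<open>If there is a crossing, then \<open>b \<notin> J\<close> and \<open>b + 1 \<in> J\<close> for some \<open>b\<close>. Swapping these two
    removes exactly one crossing and composes the shuffle with a transposition.\<close>
proof (induction "crossings J ({1..n} - J)" arbitrary: J)
  case 0
  have fin: "finite J"
    using 0(2) by (rule finite_subset) simp
  have lt: "a < c" if "a \<in> J" "c \<in> {1..n} - J" for a c
  proof -
    have "{(a, b). a \<in> J \<and> b \<in> {1..n} - J \<and> b < a} = {}"
      using 0(1) finite_crossings [OF fin, of "{1..n} - J"] by (simp add: crossings_def)
    then have "\<not> c < a"
      using that by blast
    then show ?thesis
      using that by (metis DiffE linorder_neqE_nat)
  qed
  \<comment> \<open>All of \<open>J\<close> lies below its complement, so the concatenation is the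
    strictly sorted list of \<open>{1..n}\<close>, which is unique.\<close>
  have "sorted_list_of_set J @ sorted_list_of_set ({1..n} - J) = [1..<Suc n]"
    using fin lt 0(2)
    by (intro strict_sorted_equal) (auto simp: sorted_wrt_append)
  then have "shuffle n J = id"
    by (auto simp: shuffle_def fun_eq_iff simp del: upt_Suc)
  then show ?case
    using 0(1) by simp
next
  case (Suc N)
  let ?C = "{1..n} - J"
  have fin: "finite J"
    using Suc(3) by (rule finite_subset) simp
  let ?S = "{(a, c). a \<in> J \<and> c \<in> ?C \<and> c < a}"
  have finS: "finite ?S"
    using fin by (intro finite_crossings) auto
  have "?S \<noteq> {}"
    using Suc(2) unfolding crossings_def by (metis card.empty nat.distinct(1))
  then obtain a c where ac: "a \<in> J" "c \<in> ?C" "c < a"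
    by blast
  \<comment> \<open>Going up from \<open>c\<close> outside \<open>J\<close> to \<open>a\<close>
    inside \<open>J\<close>, some unit step must enter \<open>J\<close>.\<close>
  have "\<exists>b. c \<le> b \<and> b < a \<and> b \<notin> J \<and> Suc b \<in> J"
  proof (rule ccontr)
    assume neg: "\<not> ?thesis"
    have "b \<notin> J" if "c \<le> b" "b \<le> a" for b
      using that by (induction b rule: dec_induct) (use ac neg in \<open>blast dest: Suc_leD Suc_le_lessD\<close>)+
    then show False
      using ac by auto
  qed
  then obtain b where b: "c \<le> b" "b < a" "b \<notin> J" "Suc b \<in> J"
    by blast
  have bC: "b \<in> ?C"
    using b ac Suc(3) by auto
  define t where "t = Transposition.transpose b (Suc b)"
  have tt: "t (t x) = x" for x
    by (simp add: t_def)
  have t_perm: "t permutes {1..n}"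
    unfolding t_def using bC b(4) Suc(3) by (intro permutes_swap_id) auto
  have t_less: "t x < t y \<longleftrightarrow> x < y" if "\<not> (x = b \<and> y = Suc b)" "\<not> (x = Suc b \<and> y = b)" for x y
    using that by (auto simp: t_def Transposition.transpose_def)
  define J' where "J' = t ` J"
  have J': "J' \<subseteq> {1..n}"
    unfolding J'_def using permutes_image [OF t_perm] Suc(3) by blast
  have C': "{1..n} - J' = t ` ?C"
    unfolding J'_def using permutes_image [OF t_perm] permutes_inj [OF t_perm]
    by (simp add: image_set_diff)
  \<comment> \<open>\<open>J\<close> omits \<open>b\<close> and its complement omits
    \<open>Suc b\<close>, so neither block contains the one pair whose order \<open>t\<close>
    reverses.\<close>
  have "strict_mono_on J t"
    by (rule strict_mono_onI) (metis t_less b(3))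
  moreover have "strict_mono_on ?C t"
    by (rule strict_mono_onI) (metis DiffE t_less b(4))
  ultimately have sorted: "sorted_list_of_set J' = map t (sorted_list_of_set J)"
    "sorted_list_of_set ({1..n} - J') = map t (sorted_list_of_set ?C)"
    unfolding J'_def C' [unfolded J'_def] using fin
    by (auto intro!: sorted_list_of_set_image_strict_mono)
  have len: "length (sorted_list_of_set J @ sorted_list_of_set ?C) = n"
    using Suc(3) fin card_mono [OF _ Suc(3)] by (simp add: card_Diff_subset)
  have "shuffle n J' = t \<circ> shuffle n J"
  proof
    fix k
    show "shuffle n J' k = (t \<circ> shuffle n J) k"
    proof (cases "k \<in> {1..n}")
      case True
      then have "k - 1 < length (sorted_list_of_set J @ sorted_list_of_set ?C)"
        unfolding len by auto
      then show ?thesis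
        using True unfolding shuffle_def sorted map_append [symmetric] by (simp del: map_append)
    next
      case False
      then show ?thesis
        using permutes_not_in [OF t_perm] unfolding shuffle_def by auto
    qed
  qed
  moreover have "permutation (shuffle n J)"
    using shuffle_permutes [OF Suc(3)] permutation_permutes by blast
  moreover have "permutation t" "sign t = -1"
    by (simp_all add: t_def permutation_swap_id sign_swap_id)
  ultimately have sign': "sign (shuffle n J') = - sign (shuffle n J)"
    by (simp add: sign_compose)
  \<comment> \<open>The crossing \<open>(Suc b, b)\<close> is sent to \<open>(b, Suc b)\<close>,
    which is no crossing; every other crossing remains one.\<close>
  have "{(a, c). a \<in> J' \<and> c \<in> {1..n} - J' \<and> c < a} = map_prod t t ` (?S - {(Suc b, b)})"
    (is "?S' = _")
  proof (intro equalityI subsetI)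
    fix z assume "z \<in> map_prod t t ` (?S - {(Suc b, b)})"
    then obtain x y where "z = (t x, t y)" "x \<in> J" "y \<in> ?C" "y < x" "(x, y) \<noteq> (Suc b, b)"
      by auto
    moreover from this have "t x \<in> J'" "t y \<in> {1..n} - J'"
      unfolding C' unfolding J'_def by blast+
    ultimately show "z \<in> ?S'"
      using t_less [of y x] b(3) by auto
  next
    fix z assume "z \<in> ?S'"
    then obtain x y where xy: "z = (t x, t y)" "x \<in> J" "y \<in> ?C" "t y < t x"
      unfolding C' unfolding J'_def by blast
    moreover have "(x, y) \<noteq> (Suc b, b)"
      using xy(4) by (auto simp: t_def)
    moreover have "\<not> (y = Suc b \<and> x = b)"
      using xy b by blast
    ultimately have "(x, y) \<in> ?S - {(Suc b, b)}"
      using t_less [of y x] by auto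
    then show "z \<in> map_prod t t ` (?S - {(Suc b, b)})"
      using xy(1) by (intro image_eqI [of _ _ "(x, y)"]) auto
  qed
  moreover have "inj_on (map_prod t t) A" for A
    by (rule inj_on_inverseI [of _ "map_prod t t"]) (auto simp: tt)
  ultimately have "crossings J' ({1..n} - J') = card (?S - {(Suc b, b)})"
    unfolding crossings_def by (simp add: card_image)
  also have "\<dots> = N"
    using Suc(2) b bC finS unfolding crossings_def by (subst card_Diff_singleton) auto
  finally have N: "N = crossings J' ({1..n} - J')"
    by simp
  have "sign (shuffle n J') = (-1) ^ N"
    using Suc(1) [OF N J'] N by simp
  then have "sign (shuffle n J) = (-1) ^ Suc N"
    using sign' by simp
  then show ?case
    using Suc(2) by simp
qed

text \<open>Each pair in \<open>J \<times> K\<close> has distinct entries, hence is a crossing in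
  exactly one of the two orders.\<close>

lemma crossings_commute:
  assumes "finite J" "finite K" "J \<inter> K = {}"
  shows "crossings J K + crossings K J = card J * card K"
  using assms(1,3)
proof (induction J)
  case (insert j J)
  then have "crossings ({j} \<union> J) K = crossings {j} K + crossings J K"
    "crossings K ({j} \<union> J) = crossings K {j} + crossings K J"
    using assms(2) by (intro crossings_Un_left crossings_Un_right; auto)+
  then show ?case
    using insert crossings_single_both [OF assms(2), of j] by simp
qed simp

section \<open>Coefficients of the Mui invariant\<close>

text \<open>Only the summand \<open>J = L\<close> contributes at \<open>L\<close>. Its sign is
  rewritten with \<open>crossings ({1..n} - L) L\<close>, the exponent that the Milnor operations
  produce.\<close>

lemma ecoeff_mui:
  "ecoeff (mui q n r i) L =
    (if L \<subseteq> {1..n} \<and> card L = r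
     then (-1) ^ ((n - r) * r + crossings ({1..n} - L) L) *
       (moore q (map i [1..<n - r + 1]) (sorted_list_of_set ({1..n} - L)) :: 'a::comm_ring_1 mpoly)
     else 0)"
proof -
  let ?M = "\<lambda>J. moore q (map i [1..<n - r + 1]) (sorted_list_of_set ({1..n} - J)) :: 'a mpoly"
  have summand: "ecoeff (of_int (sign (shuffle n J)) * (\<Prod>k\<leftarrow>[1..<r + 1]. dX (shuffle n J k)) *
      econst (dickson q (n - r) i (\<lambda>l. X (shuffle n J (r + l))))) L =
      (if J = L then (-1) ^ crossings L ({1..n} - L) * ?M L else 0)"
    if J: "J \<subseteq> {1..n}" "card J = r" for J
  proof -
    have fin: "finite J"
      using J(1) by (rule finite_subset) simp
    have shuffle: "map (shuffle n J) [1..<r + 1] = sorted_list_of_set J"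
      using J shuffle_nth(1) [OF J(1)] by (intro nth_equalityI) (auto simp del: upt_Suc)
    have "(\<Prod>k\<leftarrow>[1..<r + 1]. dX (shuffle n J k)) =
        ((\<Prod>k\<leftarrow>sorted_list_of_set J. dX k) :: 'a form)"
      by (simp add: shuffle [symmetric] comp_def del: upt_Suc)
    also have "\<dots> = ebasis J"
      using prod_list_dX_sorted [of "sorted_list_of_set J"] fin by simp
    finally have prod: "(\<Prod>k\<leftarrow>[1..<r + 1]. dX (shuffle n J k)) = (ebasis J :: 'a form)" .
    have "dickson q (n - r) i (\<lambda>l. X (shuffle n J (r + l))) = ?M J"
      unfolding dickson_det moore_def using J shuffle_nth(2) [OF J(1)]
      by (intro arg_cong [of _ _ Determinant.det] eq_matI) (auto simp del: upt_Suc)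
    then show ?thesis
      unfolding prod using fin by (auto simp: sign_shuffle [OF J(1)] ecoeff_ebasis simp del: upt_Suc)
  qed
  have "ecoeff (mui q n r i) L = (\<Sum>J | J \<subseteq> {1..n} \<and> card J = r.
      if J = L then (-1) ^ crossings L ({1..n} - L) * ?M L else 0)"
    unfolding mui_def ecoeff_sum by (intro sum.cong refl summand) auto
  also have "\<dots> = (if L \<subseteq> {1..n} \<and> card L = r
      then (-1) ^ crossings L ({1..n} - L) * ?M L else 0)"
    by (simp del: upt_Suc)
  finally have coeff: "ecoeff (mui q n r i) L = (if L \<subseteq> {1..n} \<and> card L = r
      then (-1) ^ crossings L ({1..n} - L) * ?M L else 0)" .
  \<comment> \<open>The two exponents differ by twice
    \<open>crossings ({1..n} - L) L\<close>.\<close>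
  have "(-1) ^ crossings L ({1..n} - L) =
      ((-1) ^ ((n - r) * r + crossings ({1..n} - L) L) :: 'a mpoly)"
    if L: "L \<subseteq> {1..n}" "card L = r"
  proof -
    have "finite L"
      using L(1) by (rule finite_subset) simp
    then have "(n - r) * r = crossings L ({1..n} - L) + crossings ({1..n} - L) L"
      using L crossings_commute [of L "{1..n} - L"] by (simp add: card_Diff_subset mult.commute)
    then show ?thesis
      by (simp add: minus_one_power_iff)
  qed
  then show ?thesis
    unfolding coeff by (intro if_cong refl arg_cong2 [where f = "(*)"]) blast
qed

section \<open>Comparison of coefficients\<close>

theorem propositionA4:
  fixes p q m n r :: nat and i :: "nat \<Rightarrow> nat"
  assumes "prime p" and "odd p" and "q = p ^ m" and "CARD('a::{field, finite}) = q"
    and "n \<ge> 1" and "r \<le> n"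
  shows "(mui q n r i :: 'a form) \<in> PE_ext n r \<and>
    (mui q n r i :: 'a form) =
      (-1) ^ ((n - r) * r) *
        fold (\<lambda>l. milnor q n (i l)) [1..<n - r + 1] (\<Prod>k\<leftarrow>[1..<n + 1]. dX k) \<and>
    (mui q n r i :: 'a form) =
      (-1) ^ ((n - r) * r + (n - r) * (n - r - 1) div 2) *
        foldr (\<lambda>l. milnor q n (i l)) [1..<n - r + 1] (\<Prod>k\<leftarrow>[1..<n + 1]. dX k)"
proof -
  define js where "js = map i [1..<n - r + 1]"
  have len: "length js = n - r"
    by (simp add: js_def del: upt_Suc)
  let ?e = "ebasis {1..n} :: 'a form"
  have vol: "(\<Prod>k\<leftarrow>[1..<n + 1]. dX k) = ?e"
    using prod_list_dX_sorted [of "[1..<n + 1]"] by (simp add: atLeastLessThanSuc_atLeastAtMost del: upt_Suc)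
  \<comment> \<open>\<open>fold\<close> applies the operation with index \<open>i 1\<close> first
    and \<open>foldr\<close> applies it last: these are the two orders of composition.\<close>
  have fold: "fold (\<lambda>l. milnor q n (i l)) [1..<n - r + 1] = fold (milnor q n) js"
    "foldr (\<lambda>l. milnor q n (i l)) [1..<n - r + 1] = foldr (milnor q n) js"
    by (simp_all add: js_def fold_map foldr_map fun_eq_iff comp_def del: upt_Suc)
  have mem: "(-1) ^ k * fold (milnor q n) js ?e \<in> PE_ext n r"
    "(-1) ^ k * foldr (milnor q n) js ?e \<in> PE_ext n r" for k
    using \<open>r \<le> n\<close> len
    by (intro PE_ext_sign_mult fold_milnor_PE_ext foldr_milnor_PE_ext ebasis_PE_ext; simp)+
  have 1: "mui q n r i = (-1) ^ ((n - r) * r) * fold (milnor q n) js ?e"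
    using \<open>r \<le> n\<close> len
    by (intro PE_ext_eqI [OF mem(1)])
       (simp add: ecoeff_mui [of q n r i, folded js_def] ecoeff_fold_milnor power_add mult_ac
         del: One_nat_def)
  have 2: "mui q n r i = (-1) ^ ((n - r) * r + (n - r) * (n - r - 1) div 2) *
      foldr (milnor q n) js ?e"
    using \<open>r \<le> n\<close> len
    by (intro PE_ext_eqI [OF mem(2)])
       (simp add: ecoeff_mui [of q n r i, folded js_def] ecoeff_foldr_milnor power_add mult_ac
         del: One_nat_def)
  \<comment> \<open>That the Mui invariant has exterior degree \<open>r\<close> is read off from its
    expression by Milnor operations.\<close>
  show ?thesis
    unfolding vol fold using 1 2 mem(1) by metis
qed

end
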